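(* Let $k$ be a real number with $9k^2>8$, let $\lambda_1=\frac{3k+\sqrt{9k^2-8}}{2}$, $\lambda_2=\frac{3k-\sqrt{9k^2-8}}{2}$, and let $\alpha=\sum_{s=0}^{7}\lambda_1^{s}e_s$, $\beta=\sum_{s=0}^{7}\lambda_2^{s}e_s$ in $\mathbb{O}$. Then for all nonnegative integers $n,r$: $$M\mathbb{O}_{k,r}M\mathbb{O}_{k,n+1}-M\mathbb{O}_{k,r+1}M\mathbb{O}_{k,n}=\frac{\alpha\beta\lambda_1^{r}\lambda_2^{n}-\beta\alpha\lambda_1^{n}\lambda_2^{r}}{\sqrt{9k^2-8}}.$$
   Context: $\mathbb{O}$ denotes the octonions, the $8$-dimensional real (non-commutative, non-associative) algebra with basis $e_0=1,e_1,\dots,e_7$ and bilinear multiplication determined by: $e_0$ is the identity, $e_a^2=-1$ for $a\ge1$, $e_ae_b=-e_be_a$ for distinct $a,b\ge1$, and $e_ae_b=e_c$, $e_be_c=e_a$, $e_ce_a=e_b$ for $(a,b,c)\in\{(1,2,3),(1,4,5),(1,7,6),(2,4,6),(2,5,7),(3,4,7),(3,6,5)\}$. The $k$-Mersenne numbers are defined by $M_{k,0}=0$, $M_{k,1}=1$, $M_{k,n+1}=3kM_{k,n}-2M_{k,n-1}$ for $n\ge1$. The $n$-th $k$-Mersenne octonion is $M\mathbb{O}_{k,n}=\sum_{s=0}^{7}M_{k,n+s}e_s$ for $n\ge 0$. *)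

theory Defs
  imports Complex_Main
begin

typedef octonion = "{x :: nat \<Rightarrow> real. \<forall>i\<ge>8. x i = 0}"
  morphisms oct_coeff Octonion
  by (rule exI[of _ "\<lambda>_. 0"]) simp

setup_lifting type_definition_octonion

lemma oct_coeff_eq_0 [simp]: "i \<ge> 8 \<Longrightarrow> oct_coeff x i = 0"
  using oct_coeff[of x] by simp

lemma octonion_eqI: "(\<And>i. i < 8 \<Longrightarrow> oct_coeff x i = oct_coeff y i) \<Longrightarrow> x = y"
  by (metis oct_coeff_eq_0 oct_coeff_inject ext linorder_not_le)

(* Only meaningful for s < 8; oct_e s = 0 otherwise. *)
lift_definition oct_e :: "nat \<Rightarrow> octonion" is "\<lambda>s i. of_bool (i = s \<and> s < 8)"
  by auto

definition oct_triples :: "(nat \<times> nat \<times> nat) set" where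
  "oct_triples = {(1,2,3), (1,4,5), (1,7,6), (2,4,6), (2,5,7), (3,4,7), (3,6,5)}"

definition oct_cyclic :: "nat \<Rightarrow> nat \<Rightarrow> nat \<Rightarrow> bool" where
  "oct_cyclic a b c \<longleftrightarrow>
     (a, b, c) \<in> oct_triples \<or> (b, c, a) \<in> oct_triples \<or> (c, a, b) \<in> oct_triples"

(* The coefficient of e_c in the product e_a e_b. *)
definition oct_struct :: "nat \<Rightarrow> nat \<Rightarrow> nat \<Rightarrow> real" where
  "oct_struct a b c =
     (if a = 0 then of_bool (c = b)
      else if b = 0 then of_bool (c = a)
      else if a = b then - of_bool (c = 0)
      else if oct_cyclic a b c then 1
      else if oct_cyclic b a c then -1
      else 0)"

instantiation octonion :: real_vector
begin

lift_definition zero_octonion :: octonion is "\<lambda>_. 0" by simp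
lift_definition plus_octonion :: "octonion \<Rightarrow> octonion \<Rightarrow> octonion"
  is "\<lambda>x y i. x i + y i" by simp
lift_definition minus_octonion :: "octonion \<Rightarrow> octonion \<Rightarrow> octonion"
  is "\<lambda>x y i. x i - y i" by simp
lift_definition uminus_octonion :: "octonion \<Rightarrow> octonion" is "\<lambda>x i. - x i" by simp
lift_definition scaleR_octonion :: "real \<Rightarrow> octonion \<Rightarrow> octonion"
  is "\<lambda>r x i. r * x i" by simp

instance
  by standard (transfer; auto simp: algebra_simps)+

end

instantiation octonion :: "{one, times}"
begin

definition one_octonion :: octonion where "1 = oct_e 0"

lift_definition times_octonion :: "octonion \<Rightarrow> octonion \<Rightarrow> octonion"
  is "\<lambda>x y c. if c < 8 then \<Sum>a<8. \<Sum>b<8. x a * y b * oct_struct a b c else 0"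
  by simp

instance ..

end

lemma oct_coeff_sum: "oct_coeff (sum f A) i = (\<Sum>x\<in>A. oct_coeff (f x) i)"
  by (induction A rule: infinite_finite_induct)
     (simp_all add: zero_octonion.rep_eq plus_octonion.rep_eq)

lemma octonion_expansion: "x = (\<Sum>s<8. oct_coeff x s *\<^sub>R oct_e s)"
proof (rule octonion_eqI)
  fix i :: nat assume i: "i < 8"
  have "oct_coeff (\<Sum>s<8. oct_coeff x s *\<^sub>R oct_e s) i
      = (\<Sum>s<8. if s = i then oct_coeff x s else 0)"
    unfolding oct_coeff_sum
    by (intro sum.cong) (auto simp: scaleR_octonion.rep_eq oct_e.rep_eq)
  thus "oct_coeff x i = oct_coeff (\<Sum>s<8. oct_coeff x s *\<^sub>R oct_e s) i"
    using i by simp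
qed

lemma octonion_mult_bilinear:
  fixes x y z :: octonion
  shows "(x + y) * z = x * z + y * z" "x * (y + z) = x * y + x * z"
    "(r *\<^sub>R x) * y = r *\<^sub>R (x * y)" "x * (r *\<^sub>R y) = r *\<^sub>R (x * y)"
  by (transfer; auto simp: algebra_simps sum.distrib sum_distrib_left fun_eq_iff)+

lemma oct_coeff_e_mult_e:
  assumes "a < 8" "b < 8"
  shows "oct_coeff (oct_e a * oct_e b) c = (if c < 8 then oct_struct a b c else 0)"
proof -
  have "oct_coeff (oct_e a) i * oct_coeff (oct_e b) j * oct_struct i j c
      = (if i = a then if j = b then oct_struct i j c else 0 else 0)" for i j
    using assms by (simp add: oct_e.rep_eq)
  hence "(\<Sum>i<8. \<Sum>j<8. oct_coeff (oct_e a) i * oct_coeff (oct_e b) j * oct_struct i j c)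
      = (\<Sum>i<8. if i = a then \<Sum>j<8. if j = b then oct_struct i j c else 0 else 0)"
    by (intro sum.cong) simp_all
  also have "\<dots> = oct_struct a b c"
    using assms by simp
  finally show ?thesis
    by (simp add: times_octonion.rep_eq)
qed

lemma octonion_mult_sum:
  fixes x :: octonion
  shows "x * sum f A = (\<Sum>s\<in>A. x * f s)" "sum f A * x = (\<Sum>s\<in>A. f s * x)"
proof -
  have "x * 0 = 0" "0 * x = 0"
    using octonion_mult_bilinear(3,4)[where r = 0] by simp_all
  thus "x * sum f A = (\<Sum>s\<in>A. x * f s)" "sum f A * x = (\<Sum>s\<in>A. f s * x)"
    by (induction A rule: infinite_finite_induct) (simp_all add: octonion_mult_bilinear)
qed

lemma octonion_mult_one: "1 * x = x" "x * 1 = (x :: octonion)"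
proof -
  have e: "1 * oct_e s = oct_e s" "oct_e s * 1 = oct_e s" if "s < 8" for s
    using that by (auto intro!: octonion_eqI
        simp: one_octonion_def oct_coeff_e_mult_e oct_struct_def oct_e.rep_eq)
  have x: "x = (\<Sum>s<8. oct_coeff x s *\<^sub>R oct_e s)"
    by (rule octonion_expansion)
  show "1 * x = x"
    by (subst (1 2) x) (simp add: octonion_mult_sum octonion_mult_bilinear e)
  show "x * 1 = x"
    by (subst (1 2) x) (simp add: octonion_mult_sum octonion_mult_bilinear e)
qed

lemma oct_e_square:
  assumes "1 \<le> a" "a < 8"
  shows "oct_e a * oct_e a = - 1"
  using assms by (intro octonion_eqI)
    (auto simp: oct_coeff_e_mult_e oct_struct_def one_octonion_def uminus_octonion.rep_eq
      oct_e.rep_eq)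

lemma oct_cyclic_unique:
  assumes "oct_cyclic a b c"
  shows "a < 8 \<and> b < 8 \<and> a \<noteq> 0 \<and> b \<noteq> 0 \<and> a \<noteq> b \<and>
    (oct_cyclic a b d \<longleftrightarrow> d = c) \<and> \<not> oct_cyclic b a d"
  using assms unfolding oct_cyclic_def oct_triples_def insert_iff empty_iff prod.inject
  by (elim disjE conjE FalseE; simp)

lemma oct_e_anticommute:
  assumes "1 \<le> a" "a < 8" "1 \<le> b" "b < 8" "a \<noteq> b"
  shows "oct_e a * oct_e b = - (oct_e b * oct_e a)"
proof (rule octonion_eqI)
  fix i
  have "oct_struct a b i = - oct_struct b a i"
    using assms oct_cyclic_unique[of a b i i] by (simp add: oct_struct_def)
  thus "oct_coeff (oct_e a * oct_e b) i = oct_coeff (- (oct_e b * oct_e a)) i"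
    using assms by (simp add: oct_coeff_e_mult_e uminus_octonion.rep_eq)
qed

lemma oct_e_cyclic:
  assumes "oct_cyclic a b c"
  shows "oct_e a * oct_e b = oct_e c"
proof (rule octonion_eqI)
  fix i :: nat assume i: "i < 8"
  have "oct_struct a b i = of_bool (i = c)"
    using oct_cyclic_unique[OF assms, of i] by (simp add: oct_struct_def)
  thus "oct_coeff (oct_e a * oct_e b) i = oct_coeff (oct_e c) i"
    using i oct_cyclic_unique[OF assms, of i] by (auto simp: oct_coeff_e_mult_e oct_e.rep_eq)
qed

lemma oct_e_triple:
  assumes "(a, b, c) \<in> oct_triples"
  shows "oct_e a * oct_e b = oct_e c" "oct_e b * oct_e c = oct_e a" "oct_e c * oct_e a = oct_e b"
  using assms by (intro oct_e_cyclic; simp add: oct_cyclic_def)+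

fun mersenne :: "real \<Rightarrow> nat \<Rightarrow> real" where
  "mersenne k 0 = 0"
| "mersenne k (Suc 0) = 1"
| "mersenne k (Suc (Suc n)) = 3 * k * mersenne k (Suc n) - 2 * mersenne k n"

definition mersenne_oct :: "real \<Rightarrow> nat \<Rightarrow> octonion" where
  "mersenne_oct k n = (\<Sum>s=0..7. mersenne k (n + s) *\<^sub>R oct_e s)"

end

theory Submission
  imports Defs
begin

text \<open>
  Since \<open>lam\<^sub>1\<close> and \<open>lam\<^sub>2\<close> are the roots of \<open>x\<^sup>2 = 3 k x - 2\<close>, which differ by
  \<open>d = sqrt (9 k\<^sup>2 - 8)\<close>, the Mersenne numbers have the Binet form
  \<open>d M\<^sub>n = lam\<^sub>1\<^sup>n - lam\<^sub>2\<^sup>n\<close> (\<open>mersenne_binet\<close>). Read in every coordinate, it gives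
  \<open>d MO\<^sub>n = lam\<^sub>1\<^sup>n \<alpha> - lam\<^sub>2\<^sup>n \<beta>\<close> (\<open>mersenne_oct_binet\<close>).

  After multiplication by \<open>d\<^sup>2\<close>, the left-hand side is a difference of two products of such
  combinations of \<open>\<alpha>\<close> and \<open>\<beta>\<close> whose exponents have the same sum \<open>r + n + 1\<close>. The squares
  \<open>\<alpha> \<alpha>\<close> and \<open>\<beta> \<beta>\<close> therefore cancel, and each mixed product keeps a factor
  \<open>lam\<^sub>1 - lam\<^sub>2 = d\<close> (\<open>octonion_binet_cross_difference\<close>). This
  is a computation in a bilinear product; as octonions do not commute, \<open>\<alpha> \<beta>\<close> and
  \<open>\<beta> \<alpha>\<close> stay separate.
\<close>

lemma octonion_mult_diff:
  fixes x y z :: octonion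
  shows "(x - y) * z = x * z - y * z" "z * (x - y) = z * x - z * y"
  using octonion_mult_bilinear(1)[of "x - y" y z] octonion_mult_bilinear(2)[of z "x - y" y]
  by (simp_all add: algebra_simps)

text \<open>
  The terms in \<open>x * x\<close> and in \<open>y * y\<close> cancel because shifting the exponent in the left or in the
  right factor gives the same power; in a mixed term the two shifts give \<open>p\<close> and \<open>q\<close>, hence the
  factor \<open>p - q\<close>.
\<close>

lemma octonion_binet_cross_difference:
  fixes x y :: octonion and p q :: real
  shows "(p ^ r *\<^sub>R x - q ^ r *\<^sub>R y) * (p ^ (n + 1) *\<^sub>R x - q ^ (n + 1) *\<^sub>R y)
       - (p ^ (r + 1) *\<^sub>R x - q ^ (r + 1) *\<^sub>R y) * (p ^ n *\<^sub>R x - q ^ n *\<^sub>R y)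
       = (p - q) *\<^sub>R ((p ^ r * q ^ n) *\<^sub>R (x * y) - (p ^ n * q ^ r) *\<^sub>R (y * x))"
  by (simp add: octonion_mult_diff octonion_mult_bilinear scaleR_diff_right scaleR_diff_left
      algebra_simps)

text \<open>
  The sum and product of \<open>p\<close> and \<open>q\<close> make them the roots of the characteristic equation of the
  recurrence. Multiplying by \<open>p - q\<close> instead of dividing by it keeps the double root in scope.
\<close>

lemma mersenne_binet:
  assumes "p + q = 3 * k" "p * q = 2"
  shows "(p - q) * mersenne k n = p ^ n - q ^ n"
proof (induction n rule: induct_nat_012)
  case (ge2 n)
  have "(p - q) * mersenne k (Suc (Suc n))
      = (p + q) * ((p - q) * mersenne k (Suc n)) - p * q * ((p - q) * mersenne k n)"
    by (simp add: assms algebra_simps)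
  also have "\<dots> = p ^ Suc (Suc n) - q ^ Suc (Suc n)"
    by (simp only: ge2) (simp add: algebra_simps)
  finally show ?case .
qed simp_all

lemma mersenne_oct_binet:
  assumes "p + q = 3 * k" "p * q = 2"
  shows "(p - q) *\<^sub>R mersenne_oct k n
       = p ^ n *\<^sub>R (\<Sum>s=0..7. p ^ s *\<^sub>R oct_e s) - q ^ n *\<^sub>R (\<Sum>s=0..7. q ^ s *\<^sub>R oct_e s)"
  unfolding mersenne_oct_def
  by (simp only: scaleR_sum_right scaleR_scaleR mersenne_binet[OF assms] power_add
      scaleR_diff_left sum_subtractf)

theorem theorem2p5:
  fixes k lam\<^sub>1 lam\<^sub>2 :: real and \<alpha> \<beta> :: octonion and n r :: nat
  assumes "9 * k\<^sup>2 > 8"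
    and "lam\<^sub>1 = (3 * k + sqrt (9 * k\<^sup>2 - 8)) / 2"
    and "lam\<^sub>2 = (3 * k - sqrt (9 * k\<^sup>2 - 8)) / 2"
    and "\<alpha> = (\<Sum>s=0..7. lam\<^sub>1 ^ s *\<^sub>R oct_e s)"
    and "\<beta> = (\<Sum>s=0..7. lam\<^sub>2 ^ s *\<^sub>R oct_e s)"
  shows "mersenne_oct k r * mersenne_oct k (n + 1) - mersenne_oct k (r + 1) * mersenne_oct k n =
    ((lam\<^sub>1 ^ r * lam\<^sub>2 ^ n) *\<^sub>R (\<alpha> * \<beta>) - (lam\<^sub>1 ^ n * lam\<^sub>2 ^ r) *\<^sub>R (\<beta> * \<alpha>)) /\<^sub>R sqrt (9 * k\<^sup>2 - 8)"
proof -
  define d where "d = sqrt (9 * k\<^sup>2 - 8)"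
  have d: "d > 0" "d\<^sup>2 = 9 * k\<^sup>2 - 8"
    using assms(1) by (simp_all add: d_def)
  have sum: "lam\<^sub>1 + lam\<^sub>2 = 3 * k" and diff: "lam\<^sub>1 - lam\<^sub>2 = d"
    using assms(2,3) by (simp_all add: d_def field_simps)
  have "lam\<^sub>1 * lam\<^sub>2 = ((3 * k)\<^sup>2 - d\<^sup>2) / 4"
    unfolding assms(2,3) d_def[symmetric] by (simp add: power2_eq_square algebra_simps)
  hence prod: "lam\<^sub>1 * lam\<^sub>2 = 2"
    by (simp add: d(2) power_mult_distrib)
  have binet: "d *\<^sub>R mersenne_oct k m = lam\<^sub>1 ^ m *\<^sub>R \<alpha> - lam\<^sub>2 ^ m *\<^sub>R \<beta>" for m
    using mersenne_oct_binet[OF sum prod, of m] by (simp only: diff assms(4,5))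
  let ?L = "mersenne_oct k r * mersenne_oct k (n + 1) - mersenne_oct k (r + 1) * mersenne_oct k n"
  let ?R = "(lam\<^sub>1 ^ r * lam\<^sub>2 ^ n) *\<^sub>R (\<alpha> * \<beta>) - (lam\<^sub>1 ^ n * lam\<^sub>2 ^ r) *\<^sub>R (\<beta> * \<alpha>)"
  have "d *\<^sub>R d *\<^sub>R ?L
      = (d *\<^sub>R mersenne_oct k r) * (d *\<^sub>R mersenne_oct k (n + 1))
      - (d *\<^sub>R mersenne_oct k (r + 1)) * (d *\<^sub>R mersenne_oct k n)"
    by (simp only: octonion_mult_bilinear scaleR_diff_right)
  also have "\<dots> = d *\<^sub>R ?R"
    by (simp only: binet octonion_binet_cross_difference diff)
  finally have "d *\<^sub>R ?L = ?R"
    by (rule scaleR_left_imp_eq[rotated]) (use d(1) in simp)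
  hence "?L = ?R /\<^sub>R d"
    using d(1) by (metis less_irrefl left_inverse scaleR_one scaleR_scaleR)
  thus ?thesis
    by (simp only: d_def)
qed

end
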